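(* Let $G$ be a finitely generated Gromov hyperbolic group which is not virtually cyclic. Let $S$ be any finite symmetric generating set of $G$ and let $d_S$ be the metric of the Cayley graph of $G$ with respect to $S$. Then there are no finite orbits in $\partial(G,d_S)$; that is, for every $h\in\partial(G,d_S)$ the orbit $G.h$ is infinite.
   Context: Cayley metric: for a finite symmetric generating set $S=S^{-1}$ of a group $G$, the Cayley graph has vertex set $G$ and edges $x\sim y\iff x^{-1}y\in S$; $d_S$ is its graph metric (the word metric), which is left-invariant, and $|x|_S=d_S(x,1)$. Gromov hyperbolic: $G$ is Gromov hyperbolic if, for some (equivalently every) Cayley metric $d$ on $G$, writing $|x|=d(x,1)$ and $(x,y)=\frac12(|x|+|y|-d(x,y))$, there exists $\delta$ such that $(x,y)\ge\min\{(x,z),(z,y)\}-\delta$ for all $x,y,z\in G$. Metric-functional boundary: for a metric $d$ on a group $G$ with base point $1$, let $L(G,d)$ be the set of functions $h:G\to\mathbb{R}$ with $h(1)=0$ and $|h(x)-h(y)|\le d(x,y)$ for all $x,y\in G$, with the topology of pointwise convergence. For $x\in G$ let $b_x(y)=d(x,y)-d(x,1)$, so $b_x\in L(G,d)$. Let $\overline{(G,d)}$ be the closure of $\{b_x : x\in G\}$ in $L(G,d)$, and $\partial(G,d)=\overline{(G,d)}\setminus\{b_x : x\in G\}$. For left-invariant $d$, the group $G$ acts on $L(G,d)$ by $(x.h)(y)=h(x^{-1}y)-h(x^{-1})$, and this action preserves $\partial(G,d)$. The orbit of $h$ is $G.h=\{x.h : x\in G\}$. *)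

theory Defs
  imports
    "HOL-Analysis.Function_Topology"
    "HOL-Algebra.Elementary_Groups"
    "HOL-Algebra.Group_Action"
begin

definition finitely_generated :: "('a, 'b) monoid_scheme \<Rightarrow> bool" where
  "finitely_generated G \<longleftrightarrow> (\<exists>A. finite A \<and> A \<subseteq> carrier G \<and> generate G A = carrier G)"

definition virtually_cyclic :: "('a, 'b) monoid_scheme \<Rightarrow> bool" where
  "virtually_cyclic G \<longleftrightarrow>
     (\<exists>H. subgroup H G \<and> cyclic_group (G\<lparr>carrier := H\<rparr>) \<and> finite (rcosets\<^bsub>G\<^esub> H))"

definition finite_symmetric_generating_set :: "('a, 'b) monoid_scheme \<Rightarrow> 'a set \<Rightarrow> bool" where
  "finite_symmetric_generating_set G S \<longleftrightarrow>
     finite S \<and> S \<subseteq> carrier G \<and> (\<lambda>s. inv\<^bsub>G\<^esub> s) ` S = S \<and> generate G S = carrier G"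

definition cayley_edges :: "('a, 'b) monoid_scheme \<Rightarrow> 'a set \<Rightarrow> 'a rel" where
  "cayley_edges G S = {(x, y). x \<in> carrier G \<and> y \<in> carrier G \<and> inv\<^bsub>G\<^esub> x \<otimes>\<^bsub>G\<^esub> y \<in> S}"

text \<open>
  The \<open>n\<close>-th relational power relates the endpoints of edge paths of length \<open>n\<close>, so this is
  the graph metric. It is meaningful on the carrier when \<open>S\<close> is symmetric and generates \<open>G\<close>;
  otherwise \<open>LEAST\<close> may be applied to an empty set of lengths.
\<close>

definition cayley_dist :: "('a, 'b) monoid_scheme \<Rightarrow> 'a set \<Rightarrow> 'a \<Rightarrow> 'a \<Rightarrow> real" where
  "cayley_dist G S x y = real (LEAST n. (x, y) \<in> cayley_edges G S ^^ n)"

definition gromov_product ::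
  "('a, 'b) monoid_scheme \<Rightarrow> ('a \<Rightarrow> 'a \<Rightarrow> real) \<Rightarrow> 'a \<Rightarrow> 'a \<Rightarrow> real" where
  "gromov_product G d x y = (d x \<one>\<^bsub>G\<^esub> + d y \<one>\<^bsub>G\<^esub> - d x y) / 2"

text \<open>
  Of the two equivalent readings (some or every Cayley metric) the existential one is taken; as a
  hypothesis it is formally the weaker one for finitely generated groups.
\<close>

definition gromov_hyperbolic :: "('a, 'b) monoid_scheme \<Rightarrow> bool" where
  "gromov_hyperbolic G \<longleftrightarrow>
     (\<exists>S. finite_symmetric_generating_set G S \<and>
       (\<exists>\<delta>. \<forall>x\<in>carrier G. \<forall>y\<in>carrier G. \<forall>z\<in>carrier G.
          gromov_product G (cayley_dist G S) x y \<ge>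
            min (gromov_product G (cayley_dist G S) x z)
                (gromov_product G (cayley_dist G S) z y) - \<delta>))"

text \<open>
  Functions from \<open>carrier G\<close> to the reals are represented by extensional functions, so that two
  of them are equal as soon as they agree on the carrier. These are also the points of the
  library's product topology indexed by \<open>carrier G\<close>, the topology of pointwise convergence.
\<close>

definition lipschitz_functionals ::
  "('a, 'b) monoid_scheme \<Rightarrow> ('a \<Rightarrow> 'a \<Rightarrow> real) \<Rightarrow> ('a \<Rightarrow> real) set" where
  "lipschitz_functionals G d =
     {h \<in> extensional (carrier G). h \<one>\<^bsub>G\<^esub> = 0 \<and>
        (\<forall>x\<in>carrier G. \<forall>y\<in>carrier G. \<bar>h x - h y\<bar> \<le> d x y)}"

definition functional_topology ::
  "('a, 'b) monoid_scheme \<Rightarrow> ('a \<Rightarrow> 'a \<Rightarrow> real) \<Rightarrow> ('a \<Rightarrow> real) topology" where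
  "functional_topology G d =
     subtopology (product_topology (\<lambda>_. euclideanreal) (carrier G)) (lipschitz_functionals G d)"

definition internal_functional ::
  "('a, 'b) monoid_scheme \<Rightarrow> ('a \<Rightarrow> 'a \<Rightarrow> real) \<Rightarrow> 'a \<Rightarrow> 'a \<Rightarrow> real" where
  "internal_functional G d x = (\<lambda>y\<in>carrier G. d x y - d x \<one>\<^bsub>G\<^esub>)"

text \<open>
  The qualified prefix form avoids a clash with the \<open>closure_of\<close> syntax of HOL-Algebra.
\<close>

definition metric_functional_compactification ::
  "('a, 'b) monoid_scheme \<Rightarrow> ('a \<Rightarrow> 'a \<Rightarrow> real) \<Rightarrow> ('a \<Rightarrow> real) set" where
  "metric_functional_compactification G d =
     Abstract_Topology.closure_of (functional_topology G d) (internal_functional G d ` carrier G)"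

definition metric_functional_boundary ::
  "('a, 'b) monoid_scheme \<Rightarrow> ('a \<Rightarrow> 'a \<Rightarrow> real) \<Rightarrow> ('a \<Rightarrow> real) set" where
  "metric_functional_boundary G d =
     metric_functional_compactification G d - internal_functional G d ` carrier G"

definition functional_action ::
  "('a, 'b) monoid_scheme \<Rightarrow> 'a \<Rightarrow> ('a \<Rightarrow> real) \<Rightarrow> ('a \<Rightarrow> real)" where
  "functional_action G x h =
     (\<lambda>y\<in>carrier G. h (inv\<^bsub>G\<^esub> x \<otimes>\<^bsub>G\<^esub> y) - h (inv\<^bsub>G\<^esub> x))"

end

theory Submission
  imports Defs "HOL-Analysis.Abstract_Metric_Spaces" "HOL-Real_Asymp.Real_Asymp"
begin

text \<open>
  If the orbit of a boundary point \<open>h\<close> is finite, the stabilizer of \<open>h\<close> has finite index and \<open>h\<close>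
  restricts to a homomorphism on it. On any finite set \<open>h\<close> coincides with some \<open>b\<^sub>x\<close> for \<open>x\<close>
  arbitrarily far away. Let \<open>\<alpha>\<close> be a geodesic from \<open>\<one>\<close> to \<open>x\<close>. For \<open>q\<close> in the stabilizer with
  \<open>\<bar>h q\<bar> \<le> c\<close>, the translate of a long initial part of \<open>\<alpha>\<close> by \<open>q\<close> extends to a geodesic from \<open>q\<close>
  to the same \<open>x\<close>. Both are quasi-geodesics for the hyperbolic word metric, so by the Morse lemma
  they pass close to each other, and the values of \<open>h\<close> synchronize them: \<open>\<alpha> n\<close> and \<open>q \<otimes> \<alpha> n\<close> are
  at a distance bounded independently of \<open>q\<close>, with \<open>n\<close> independent of \<open>q\<close>. Counting the conjugates
  \<open>inv (\<alpha> n) \<otimes> q \<otimes> \<alpha> n\<close> in a ball bounds the number of such \<open>q\<close>. Hence an element \<open>t\<close> of the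
  stabilizer with \<open>h t \<noteq> 0\<close> generates a subgroup of finite index, and if there is no such \<open>t\<close> the
  group is finite.
\<close>

section \<open>Discrete geodesics, hyperbolic spaces and the Morse lemma\<close>

definition geodesic_path :: "('a \<Rightarrow> 'a \<Rightarrow> real) \<Rightarrow> (nat \<Rightarrow> 'a) \<Rightarrow> nat \<Rightarrow> bool" where
  "geodesic_path d p n \<longleftrightarrow> (\<forall>i\<le>n. \<forall>j\<le>n. d (p i) (p j) = \<bar>real i - real j\<bar>)"

text \<open>If some subpath had a shortcut, the remaining unit steps could not bring the distance of
  the endpoints up to \<open>n\<close>.\<close>

lemma (in Metric_space) geodesic_pathI:
  assumes inM: "\<And>i. i \<le> n \<Longrightarrow> p i \<in> M"
    and step: "\<And>i. i < n \<Longrightarrow> d (p i) (p (Suc i)) \<le> 1"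
    and len: "real n \<le> d (p 0) (p n)"
  shows "geodesic_path d p n"
proof -
  have up: "d (p i) (p j) \<le> real j - real i" if "i \<le> j" "j \<le> n" for i j
    using that
  proof (induction j rule: dec_induct)
    case base
    then show ?case using inM by simp
  next
    case (step j)
    have "d (p i) (p (Suc j)) \<le> d (p i) (p j) + d (p j) (p (Suc j))"
      using step inM by (intro triangle) auto
    then show ?case using step assms(2)[of j] by auto
  qed
  have eq: "d (p i) (p j) = real j - real i" if "i \<le> j" "j \<le> n" for i j
  proof -
    have "d (p 0) (p n) \<le> d (p 0) (p i) + (d (p i) (p j) + d (p j) (p n))"
      using triangle[of "p 0" "p i" "p n"] triangle[of "p i" "p j" "p n"] inM that by auto
    then show ?thesis
      using up[of 0 i] up[of i j] up[of j n] that len by auto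
  qed
  show ?thesis
    unfolding geodesic_path_def
  proof (intro allI impI)
    fix i j assume "i \<le> n" "j \<le> n"
    then show "d (p i) (p j) = \<bar>real i - real j\<bar>"
      using eq[of i j] eq[of j i] commute[of "p i" "p j"] by (cases "i \<le> j") auto
  qed
qed

text \<open>The base point \<open>w\<close> is arbitrary, whereas \<open>gromov_hyperbolic\<close>
  fixes it at the identity. The arguments below need Gromov products based at points along
  geodesics.\<close>

locale hyperbolic_space = Metric_space +
  fixes \<delta> :: real
  assumes \<delta>_nonneg: "\<delta> \<ge> 0"
    and four_point: "\<And>w x y z. \<lbrakk>w \<in> M; x \<in> M; y \<in> M; z \<in> M\<rbrakk> \<Longrightarrow>
      (d x w + d y w - d x y) / 2
        \<ge> min ((d x w + d z w - d x z) / 2) ((d z w + d y w - d z y) / 2) - \<delta>"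
begin

definition gp :: "'a \<Rightarrow> 'a \<Rightarrow> 'a \<Rightarrow> real" where
  "gp w x y = (d x w + d y w - d x y) / 2"

lemma gp_commute: "gp w x y = gp w y x"
  by (simp add: gp_def commute)

lemma gp_ge_min:
  "\<lbrakk>w \<in> M; x \<in> M; y \<in> M; z \<in> M\<rbrakk> \<Longrightarrow> gp w x y \<ge> min (gp w x z) (gp w z y) - \<delta>"
  using four_point by (simp add: gp_def)

lemma gp_ge_diff:
  assumes "w \<in> M" "x \<in> M" "y \<in> M"
  shows "gp w x y \<ge> d x w - d x y"
  using triangle[of x y w] assms by (simp add: gp_def field_simps)

lemma gp_self: "x \<in> M \<Longrightarrow> gp w x x = d x w"
  by (simp add: gp_def)

text \<open>Halving the chain costs one \<delta> per level, so the loss is only logarithmic in the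
  number of points. The hypothesis on self-products covers the chain of a single point.\<close>

lemma gp_chain:
  assumes "w \<in> M" "N \<le> 2 ^ k" "\<And>i. i \<le> N \<Longrightarrow> p i \<in> M"
    and "\<And>i. i < N \<Longrightarrow> gp w (p i) (p (Suc i)) \<ge> c"
    and "\<And>i. i \<le> N \<Longrightarrow> gp w (p i) (p i) \<ge> c"
  shows "gp w (p 0) (p N) \<ge> c - real k * \<delta>"
  using assms(2-)
proof (induction k arbitrary: N p)
  case 0
  then have "N = 0 \<or> N = 1" by auto
  then show ?case using 0 by auto
next
  case (Suc k)
  define m where "m = N div 2"
  have m: "m \<le> N" "m \<le> 2 ^ k" "N - m \<le> 2 ^ k"
    using Suc.prems(1) by (auto simp: m_def)
  have 1: "gp w (p 0) (p m) \<ge> c - real k * \<delta>"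
    using Suc.prems m by (intro Suc.IH) auto
  have 2: "gp w (p (m + 0)) (p (m + (N - m))) \<ge> c - real k * \<delta>"
    using Suc.prems m by (intro Suc.IH[of "N - m" "\<lambda>i. p (m + i)"]) auto
  have "gp w (p 0) (p N) \<ge> min (gp w (p 0) (p m)) (gp w (p m) (p N)) - \<delta>"
    using Suc.prems m assms(1) by (intro gp_ge_min) auto
  then show ?case using 1 2 m by (auto simp: algebra_simps)
qed

text \<open>This is exponential divergence: a path with bounded steps that stays far from
  \<open>w\<close> needs exponentially many of them to join two points with small product at
  \<open>w\<close>.\<close>

lemma gp_far_path:
  assumes "w \<in> M" "N \<le> 2 ^ k" "\<And>i. i \<le> N \<Longrightarrow> p i \<in> M"
    and far: "\<And>i. i \<le> N \<Longrightarrow> d w (p i) \<ge> c"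
    and step: "\<And>i. i < N \<Longrightarrow> d (p i) (p (Suc i)) \<le> L"
    and "L \<ge> 0"
  shows "gp w (p 0) (p N) \<ge> c - L / 2 - real k * \<delta>"
proof (rule gp_chain)
  fix i assume i: "i < N"
  then show "gp w (p i) (p (Suc i)) \<ge> c - L / 2"
    using far[of i] far[of "Suc i"] step[of i] by (simp add: gp_def commute field_simps)
next
  fix i assume i: "i \<le> N"
  then show "gp w (p i) (p i) \<ge> c - L / 2"
    using far[of i] \<open>L \<ge> 0\<close> assms(3) by (simp add: gp_self commute)
qed (use assms in auto)

text \<open>Quasi-geodesics in integer time without additive constant. Geodesics of one word metric
  have this form for another one, the two metrics being bilipschitz equivalent.\<close>

definition bilipschitz_path :: "real \<Rightarrow> (nat \<Rightarrow> 'a) \<Rightarrow> nat \<Rightarrow> bool" where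
  "bilipschitz_path L p n \<longleftrightarrow> (\<forall>i\<le>n. \<forall>j\<le>n.
     d (p i) (p j) \<le> L * \<bar>real i - real j\<bar> \<and> \<bar>real i - real j\<bar> \<le> L * d (p i) (p j))"

text \<open>
  The four-point condition is applied along a path from \<open>g a\<close> to \<open>g b\<close> (two points of the geodesic
  on either side of \<open>g m\<close>, at distance \<open>2 D\<close> from it or endpoints) by way of \<open>p\<close>. The path stays
  far from \<open>g m\<close> but uses only \<open>O(D)\<close> steps, so the Gromov product at \<open>g m\<close>, which is \<open>0\<close>, is at
  least \<open>D - O(log D)\<close>.
\<close>

lemma farthest_point_bound:
  assumes L: "L \<ge> 1"
    and gM: "g ` {..n} \<subseteq> M" and g2: "geodesic_path d g n"
    and pM: "p ` {..N} \<subseteq> M" and p2: "bilipschitz_path L p N"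
    and ends: "p 0 = g 0" "p N = g n"
    and near: "\<And>i. i \<le> n \<Longrightarrow> \<exists>j\<le>N. d (g i) (p j) \<le> real D"
    and m: "m \<le> n" and far: "\<And>j. j \<le> N \<Longrightarrow> d (g m) (p j) \<ge> real D - 1"
    and k: "6 * L * real D \<le> 2 ^ k"
  shows "real D \<le> 1 + L / 2 + (real k + 2) * \<delta>"
proof -
  have g: "g i \<in> M" if "i \<le> n" for i
    using gM that by auto
  have p: "p i \<in> M" if "i \<le> N" for i
    using pM that by auto
  have gd: "d (g i) (g j) = \<bar>real i - real j\<bar>" if "i \<le> n" "j \<le> n" for i j
    using g2 that by (auto simp: geodesic_path_def)
  have pd: "d (p i) (p j) \<le> L * \<bar>real i - real j\<bar>" "\<bar>real i - real j\<bar> \<le> L * d (p i) (p j)"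
    if "i \<le> N" "j \<le> N" for i j
    using p2 that by (auto simp: bilipschitz_path_def)
  \<comment> \<open>Away from the end, the distance \<open>2 * D\<close> to \<open>g m\<close> minus
    a jump of length at most \<open>D\<close> bounds the product from below. Near the end the jump
    is trivial, as \<open>p\<close> and \<open>g\<close> share their endpoints, and
    \<open>far\<close> gives the bound.\<close>
  obtain a i where a: "a \<le> m" "real m - real a \<le> 2 * real D" "i \<le> N" "d (g a) (p i) \<le> real D"
      "gp (g m) (g a) (p i) \<ge> real D - 1"
  proof (cases "2 * D \<le> m")
    case True
    then obtain i where i: "i \<le> N" "d (g (m - 2 * D)) (p i) \<le> real D"
      using near m by (meson diff_le_self le_trans)
    have "gp (g m) (g (m - 2 * D)) (p i) \<ge> d (g (m - 2 * D)) (g m) - d (g (m - 2 * D)) (p i)"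
      using g p i m by (intro gp_ge_diff) auto
    then show thesis
      using True i m gd[of "m - 2 * D" m] by (intro that[of "m - 2 * D" i]) auto
  next
    case False
    then show thesis
      using m g p ends far[of 0]
      by (intro that[of 0 0]) (auto simp: gp_self commute)
  qed
  obtain b j where b: "m \<le> b" "b \<le> n" "real b - real m \<le> 2 * real D" "j \<le> N"
      "d (g b) (p j) \<le> real D" "gp (g m) (g b) (p j) \<ge> real D - 1"
  proof (cases "m + 2 * D \<le> n")
    case True
    then obtain i where i: "i \<le> N" "d (g (m + 2 * D)) (p i) \<le> real D"
      using near[of "m + 2 * D"] m by auto
    have "gp (g m) (g (m + 2 * D)) (p i) \<ge> d (g (m + 2 * D)) (g m) - d (g (m + 2 * D)) (p i)"
      using g p i m True by (intro gp_ge_diff) auto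
    then show thesis
      using True i m gd[of "m + 2 * D" m] by (intro that[of "m + 2 * D" i]) auto
  next
    case False
    then show thesis
      using m g p[of N] ends far[of N]
      by (intro that[of n N]) (auto simp: gp_self commute)
  qed
  have chain: "gp (g m) (p i) (p j) \<ge> real D - 1 - L / 2 - real k * \<delta>"
    if ij: "i \<le> j" "j \<le> N" and dij: "d (p i) (p j) \<le> 6 * real D" for i j
  proof -
    have "real (j - i) \<le> L * d (p i) (p j)"
      using pd(2)[of i j] ij by auto
    also have "\<dots> \<le> L * (6 * real D)"
      using dij L by (intro mult_left_mono) auto
    also have "\<dots> \<le> 2 ^ k"
      using k by (simp add: mult_ac)
    finally have "real (j - i) \<le> real (2 ^ k)" by simp
    then have "j - i \<le> 2 ^ k" by (simp only: of_nat_le_iff)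
    then have "gp (g m) (p (i + 0)) (p (i + (j - i))) \<ge> real D - 1 - L / 2 - real k * \<delta>"
    proof (intro gp_far_path[where p = "\<lambda>l. p (i + l)"])
      fix l assume "l < j - i"
      then show "d (p (i + l)) (p (i + Suc l)) \<le> L"
        using pd(1)[of "i + l" "i + Suc l"] ij by auto
    qed (use g p m far L ij in auto)
    then show ?thesis using ij by simp
  qed
  \<comment> \<open>Two jumps of length at most \<open>D\<close> and a piece of \<open>g\<close> of
    length at most \<open>4 * D\<close>: this is the 6 in the hypothesis on
    \<open>k\<close>.\<close>
  have "d (p i) (p j) \<le> d (p i) (g a) + (d (g a) (g b) + d (g b) (p j))"
    using triangle[of "p i" "g a" "p j"] triangle[of "g a" "g b" "p j"] a b m g p by auto
  then have "d (p i) (p j) \<le> 6 * real D"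
    using a b m gd[of a b] by (auto simp: commute)
  then have mid: "gp (g m) (p i) (p j) \<ge> real D - 1 - L / 2 - real k * \<delta>"
    using chain[of i j] chain[of j i] a b by (cases "i \<le> j") (auto simp: commute gp_commute)
  \<comment> \<open>The point \<open>g m\<close> lies on the geodesic between them. Joining the two
    jumps to the path along \<open>p\<close> costs two more \<delta>, hence \<open>k + 2\<close> in
    the conclusion.\<close>
  have "gp (g m) (g a) (g b) = 0"
    using gd[of a m] gd[of b m] gd[of a b] a b m by (simp add: gp_def)
  moreover have "gp (g m) (g a) (g b) \<ge> min (gp (g m) (g a) (p i)) (gp (g m) (p i) (g b)) - \<delta>"
    using a b m g p by (intro gp_ge_min) auto
  moreover have "gp (g m) (p i) (g b) \<ge> min (gp (g m) (p i) (p j)) (gp (g m) (p j) (g b)) - \<delta>"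
    using a b m g p by (intro gp_ge_min) auto
  moreover have "0 \<le> real k * \<delta>"
    using \<delta>_nonneg by simp
  ultimately show ?thesis
    using a(5) b(6) mid L \<delta>_nonneg gp_commute[of "g m" "p j" "g b"]
    unfolding distrib_right by linarith
qed

text \<open>The optimal integer deviation is bounded by a constant plus a multiple of its own
  logarithm, which fails beyond some threshold. That threshold is fixed before the paths
  are.\<close>

lemma morse:
  assumes L: "L \<ge> 1"
  obtains D where "D \<ge> 0" and
    "\<And>g n p N i. \<lbrakk>g ` {..n} \<subseteq> M; geodesic_path d g n; p ` {..N} \<subseteq> M;
       bilipschitz_path L p N; p 0 = g 0; p N = g n; i \<le> n\<rbrakk> \<Longrightarrow> \<exists>j\<le>N. d (g i) (p j) \<le> D"
proof -
  have "filterlim (\<lambda>x::real. x - (1 + L / 2 + (log 2 (6 * L * x) + 3) * \<delta>)) at_top at_top"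
    using L \<delta>_nonneg by real_asymp
  then have "eventually (\<lambda>x. x > 1 + L / 2 + (log 2 (6 * L * x) + 3) * \<delta>) at_top"
    by (rule eventually_mono[OF filterlim_at_top_dense[THEN iffD1, rule_format, of _ _ 0]]) auto
  then obtain D\<^sub>0 where D\<^sub>0: "\<And>x. x \<ge> D\<^sub>0 \<Longrightarrow> x > 1 + L / 2 + (log 2 (6 * L * x) + 3) * \<delta>"
    by (auto simp: eventually_at_top_linorder)
  show thesis
  proof (rule that[of "max 1 D\<^sub>0"])
    fix g n p N i
    assume g: "g ` {..n} \<subseteq> M" "geodesic_path d g n"
      and p: "p ` {..N} \<subseteq> M" "bilipschitz_path L p N"
      and ends: "p 0 = g 0" "p N = g n" and i: "i \<le> n"
    define near where "near D \<longleftrightarrow> (\<forall>i\<le>n. \<exists>j\<le>N. d (g i) (p j) \<le> real D)" for D :: nat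
    have "near n"
      unfolding near_def
    proof (intro allI impI exI conjI)
      fix i assume "i \<le> n"
      then show "d (g i) (p 0) \<le> real n"
        using g(2) by (auto simp: ends geodesic_path_def)
    qed auto
    \<comment> \<open>Minimality of \<open>D\<close> among natural numbers provides a point
      \<open>g m\<close> farther than \<open>D - 1\<close> from all of \<open>p\<close>; this is why
      the previous lemma asks only for \<open>real D - 1\<close>.\<close>
    define D where "D = (LEAST D. near D)"
    have nearD: "near D" unfolding D_def using \<open>near n\<close> by (rule LeastI)
    have "real D \<le> max 1 D\<^sub>0"
    proof (rule ccontr)
      assume "\<not> ?thesis"
      then have big: "real D > 1" "real D > D\<^sub>0" by auto
      then have "\<not> near (D - 1)"
        unfolding D_def by (intro not_less_Least) (auto simp: D_def)
      then obtain m where m: "m \<le> n" "\<And>j. j \<le> N \<Longrightarrow> d (g m) (p j) > real (D - 1)"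
        unfolding near_def by (meson not_le)
      \<comment> \<open>Rounding the logarithm up adds at most 1, which turns \<open>k + 2\<close>
        into the summand 3 in the choice of \<open>D\<^sub>0\<close>.\<close>
      define k where "k = nat \<lceil>log 2 (6 * L * real D)\<rceil>"
      have pos: "6 * L * real D \<ge> 1" using big L by (simp add: mult_ge1_I)
      then have "log 2 (6 * L * real D) \<ge> 0" by simp
      then have k: "log 2 (6 * L * real D) \<le> real k" "real k \<le> log 2 (6 * L * real D) + 1"
        unfolding k_def by linarith+
      have "6 * L * real D \<le> 2 ^ k"
        using k(1) pos by (simp add: log_le_iff powr_realpow)
      then have "real D \<le> 1 + L / 2 + (real k + 2) * \<delta>"
        using nearD m big
        by (intro farthest_point_bound[OF L g p ends _ m(1)])
           (force simp: near_def intro: less_imp_le)+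
      also have "\<dots> \<le> 1 + L / 2 + (log 2 (6 * L * real D) + 3) * \<delta>"
        using k \<delta>_nonneg by (intro add_left_mono mult_right_mono) auto
      finally show False using D\<^sub>0[of "real D"] big by simp
    qed
    then show "\<exists>j\<le>N. d (g i) (p j) \<le> max 1 D\<^sub>0"
      using nearD i unfolding near_def by (meson order_trans)
  qed auto
qed

text \<open>The point \<open>g a\<close> is as far from \<open>g 0\<close> as \<open>z\<close> is,
  so the products at \<open>z\<close> of \<open>g a\<close> with both endpoints are at least half of
  \<open>d z (g a)\<close>. The four-point condition then bounds this distance. If \<open>a\<close>
  exceeds the length of \<open>g\<close>, the endpoint \<open>g n\<close> is close enough.\<close>

lemma geodesic_near_point:
  assumes gM: "g ` {..n} \<subseteq> M" and g2: "geodesic_path d g n" and z: "z \<in> M"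
    and e: "gp z (g 0) (g n) \<le> \<delta>"
    and int: "d (g 0) z = real a"
  shows "\<exists>i\<le>n. d z (g i) \<le> 4 * \<delta>"
proof -
  have g: "g i \<in> M" if "i \<le> n" for i
    using gM that by auto
  have gd: "d (g i) (g j) = \<bar>real i - real j\<bar>" if "i \<le> n" "j \<le> n" for i j
    using g2 that by (auto simp: geodesic_path_def)
  have sum: "real a + d (g n) z \<le> real n + 2 * \<delta>"
    using e int gd[of 0 n] by (simp add: gp_def field_simps)
  show ?thesis
  proof (cases "a \<le> n")
    case True
    have "gp z (g 0) (g n) \<ge> min (gp z (g 0) (g a)) (gp z (g a) (g n)) - \<delta>"
      using g z True by (intro gp_ge_min) auto
    then have "d z (g a) \<le> 4 * \<delta>"
      using e sum int True gd[of 0 a] gd[of a n] gd[of 0 n] commute[of z "g a"] \<delta>_nonneg 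
         nonneg[of z "g n"] triangle[of "g 0" z "g n"] g[of 0] g[of n] z commute[of z "g n"] 
      by (auto simp: gp_def min_def field_simps split: if_splits)
    then show ?thesis using True by auto
  next
    case False
    then have "d z (g n) \<le> 4 * \<delta>"
      using sum \<delta>_nonneg by (simp add: commute)
    then show ?thesis by auto
  qed
qed

end

section \<open>Word metrics: invariance, geodesics, local finiteness and comparison\<close>

locale word_metric = group G for G (structure) +
  fixes S
  assumes generating: "finite_symmetric_generating_set G S"
begin

lemma finite_S: "finite S" and S_carrier: "S \<subseteq> carrier G"
  and S_inv: "s \<in> S \<Longrightarrow> inv s \<in> S" and S_generates: "generate G S = carrier G"
  using generating by (auto simp: finite_symmetric_generating_set_def)

lemma edge_inv: "(x, y) \<in> cayley_edges G S \<Longrightarrow> (y, x) \<in> cayley_edges G S"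
  using S_inv[of "inv x \<otimes> y"] by (auto simp: cayley_edges_def inv_mult_group)

lemma relpow_edge_inv: "(x, y) \<in> cayley_edges G S ^^ n \<longleftrightarrow> (y, x) \<in> cayley_edges G S ^^ n"
proof -
  have "(y, x) \<in> cayley_edges G S ^^ n" if "(x, y) \<in> cayley_edges G S ^^ n" for x y
    using that
  proof (induction n arbitrary: y)
    case (Suc n)
    then obtain z where "(z, x) \<in> cayley_edges G S ^^ n" "(z, y) \<in> cayley_edges G S"
      by auto
    then show ?case using edge_inv relpow_Suc_I2 by metis
  qed auto
  then show ?thesis by blast
qed

lemma relpow_edge_translate:
  assumes "g \<in> carrier G"
  shows "(x, y) \<in> cayley_edges G S ^^ n \<Longrightarrow> (g \<otimes> x, g \<otimes> y) \<in> cayley_edges G S ^^ n"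
proof (induction n arbitrary: y)
  case (Suc n)
  then obtain z where z: "(x, z) \<in> cayley_edges G S ^^ n" "(z, y) \<in> cayley_edges G S"
    by auto
  then have "(g \<otimes> z, g \<otimes> y) \<in> cayley_edges G S"
    using assms by (auto simp: cayley_edges_def inv_mult_group m_assoc
        m_assoc[of "inv g" g, symmetric])
  then show ?case using Suc.IH[OF z(1)] by auto
qed auto

lemma edge_path_exists:
  assumes "x \<in> carrier G" "y \<in> carrier G"
  shows "\<exists>n. (x, y) \<in> cayley_edges G S ^^ n"
proof -
  have *: "\<exists>n. (\<one>, z) \<in> cayley_edges G S ^^ n" if "z \<in> generate G S" for z
    using that
  proof induction
    case one
    show ?case by (rule exI[of _ 0]) simp
  next
    case (incl h)
    then show ?case using S_carrier by (intro exI[of _ 1]) (auto simp: cayley_edges_def)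
  next
    case (inv h)
    then show ?case using S_carrier S_inv by (intro exI[of _ 1]) (auto simp: cayley_edges_def)
  next
    case (eng a b)
    then obtain m n where "(\<one>, a) \<in> cayley_edges G S ^^ m" "(\<one>, b) \<in> cayley_edges G S ^^ n"
      by auto
    then have "(\<one>, a) \<in> cayley_edges G S ^^ m" "(a \<otimes> \<one>, a \<otimes> b) \<in> cayley_edges G S ^^ n"
      using relpow_edge_translate[of a \<one> b n] eng S_generates by auto
    then show ?case
      using eng S_generates by (auto intro: relpow_trans)
  qed
  obtain n where "(\<one>, inv x \<otimes> y) \<in> cayley_edges G S ^^ n"
    using *[of "inv x \<otimes> y"] assms S_generates by auto
  then have "(x \<otimes> \<one>, x \<otimes> (inv x \<otimes> y)) \<in> cayley_edges G S ^^ n"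
    using assms by (intro relpow_edge_translate)
  then show ?thesis using assms by (auto simp flip: m_assoc)
qed

lemma dist_le: "(x, y) \<in> cayley_edges G S ^^ n \<Longrightarrow> cayley_dist G S x y \<le> real n"
  unfolding cayley_dist_def by (simp add: Least_le)

lemma dist_attained:
  assumes "x \<in> carrier G" "y \<in> carrier G"
  obtains n where "cayley_dist G S x y = real n" "(x, y) \<in> cayley_edges G S ^^ n"
  using LeastI_ex[OF edge_path_exists[OF assms]] unfolding cayley_dist_def by blast

sublocale Metric_space "carrier G" "cayley_dist G S"
proof
  fix x y
  show "0 \<le> cayley_dist G S x y" by (simp add: cayley_dist_def)
  \<comment> \<open>Symmetry is demanded outside the carrier as well; it holds there because both
    sides take \<open>LEAST\<close> of the same set of lengths.\<close>
  show "cayley_dist G S x y = cayley_dist G S y x"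
    unfolding cayley_dist_def by (subst relpow_edge_inv) simp
next
  fix x y assume xy: "x \<in> carrier G" "y \<in> carrier G"
  show "cayley_dist G S x y = 0 \<longleftrightarrow> x = y"
  proof
    assume "cayley_dist G S x y = 0"
    then show "x = y" using dist_attained[OF xy] by (metis of_nat_eq_0_iff relpow_0_E)
  next
    assume "x = y"
    then have "(x, y) \<in> cayley_edges G S ^^ 0" by simp
    from dist_le[OF this] show "cayley_dist G S x y = 0" by (simp add: cayley_dist_def)
  qed
next
  fix x y z assume "x \<in> carrier G" "y \<in> carrier G" "z \<in> carrier G"
  then obtain m n where "cayley_dist G S x y = real m" "(x, y) \<in> cayley_edges G S ^^ m"
    "cayley_dist G S y z = real n" "(y, z) \<in> cayley_edges G S ^^ n"
    by (metis dist_attained)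
  then show "cayley_dist G S x z \<le> cayley_dist G S x y + cayley_dist G S y z"
    using dist_le[OF relpow_trans] by fastforce
qed

lemma dist_translate:
  assumes "g \<in> carrier G" "x \<in> carrier G" "y \<in> carrier G"
  shows "cayley_dist G S (g \<otimes> x) (g \<otimes> y) = cayley_dist G S x y"
proof -
  have le: "cayley_dist G S (g \<otimes> x) (g \<otimes> y) \<le> cayley_dist G S x y"
    if "g \<in> carrier G" "x \<in> carrier G" "y \<in> carrier G" for g x y
    using that by (metis dist_attained dist_le relpow_edge_translate)
  show ?thesis
    using le[of g x y] le[of "inv g" "g \<otimes> x" "g \<otimes> y"] assms by (simp flip: m_assoc)
qed

lemma geodesic_exists:
  assumes "x \<in> carrier G" "y \<in> carrier G"
  obtains p n where "cayley_dist G S x y = real n" "p 0 = x" "p n = y"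
    "p ` {..n} \<subseteq> carrier G" "geodesic_path (cayley_dist G S) p n"
proof -
  obtain n where n: "cayley_dist G S x y = real n" "(x, y) \<in> cayley_edges G S ^^ n"
    using dist_attained assms by blast
  then obtain p where p: "p 0 = x" "p n = y" "\<And>i. i < n \<Longrightarrow> (p i, p (Suc i)) \<in> cayley_edges G S"
    by (auto simp: relpow_fun_conv)
  have inG: "p i \<in> carrier G" if "i \<le> n" for i
    using that p(1) p(3)[of "i - 1"] assms by (cases i) (auto simp: cayley_edges_def)
  have "geodesic_path (cayley_dist G S) p n"
  proof (rule geodesic_pathI)
    fix i assume "i < n"
    then have "(p i, p (Suc i)) \<in> cayley_edges G S ^^ 1" using p by simp
    from dist_le[OF this] show "cayley_dist G S (p i) (p (Suc i)) \<le> 1" by simp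
  qed (use inG n p in auto)
  then show thesis using that n p inG by (metis atMost_iff image_subsetI)
qed

lemma finite_ball: "finite {x \<in> carrier G. cayley_dist G S \<one> x \<le> r}"
proof -
  have fin: "finite ((cayley_edges G S ^^ n) `` {\<one>})" for n
  proof (induction n)
    case (Suc n)
    have "(cayley_edges G S ^^ Suc n) `` {\<one>}
        \<subseteq> (\<lambda>(x, s). x \<otimes> s) ` (((cayley_edges G S ^^ n) `` {\<one>}) \<times> S)"
    proof
      fix y assume "y \<in> (cayley_edges G S ^^ Suc n) `` {\<one>}"
      then obtain z where z: "(\<one>, z) \<in> cayley_edges G S ^^ n" "(z, y) \<in> cayley_edges G S" by auto
      then have "y = z \<otimes> (inv z \<otimes> y)" "inv z \<otimes> y \<in> S"
        by (auto simp: cayley_edges_def simp flip: m_assoc)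
      then show "y \<in> (\<lambda>(x, s). x \<otimes> s) ` (((cayley_edges G S ^^ n) `` {\<one>}) \<times> S)"
        using z by force
    qed
    then show ?case
      by (rule finite_subset) (use Suc finite_S in auto)
  qed auto
  have "{x \<in> carrier G. cayley_dist G S \<one> x \<le> r}
      \<subseteq> (\<Union>n\<le>nat \<lfloor>r\<rfloor>. (cayley_edges G S ^^ n) `` {\<one>})"
  proof
    fix x assume x: "x \<in> {x \<in> carrier G. cayley_dist G S \<one> x \<le> r}"
    then obtain n where "cayley_dist G S \<one> x = real n" "(\<one>, x) \<in> cayley_edges G S ^^ n"
      using dist_attained[of \<one> x] by auto
    then show "x \<in> (\<Union>n\<le>nat \<lfloor>r\<rfloor>. (cayley_edges G S ^^ n) `` {\<one>})"
      using x by (auto simp: le_nat_floor)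
  qed
  then show ?thesis using fin by (auto intro: finite_subset)
qed

text \<open>By invariance an edge has \<open>d'\<close>-length equal to that of its generator.
  Applied in both directions, this makes any two word metrics bilipschitz equivalent.\<close>

lemma dominates_invariant_metric:
  assumes "Metric_space (carrier G) d'"
    and inv: "\<And>g x y. \<lbrakk>g \<in> carrier G; x \<in> carrier G; y \<in> carrier G\<rbrakk> \<Longrightarrow>
      d' (g \<otimes> x) (g \<otimes> y) = d' x y"
  obtains L where "L \<ge> 0"
    "\<And>x y. \<lbrakk>x \<in> carrier G; y \<in> carrier G\<rbrakk> \<Longrightarrow> d' x y \<le> L * cayley_dist G S x y"
proof -
  interpret d': Metric_space "carrier G" d' by fact
  \<comment> \<open>A sum instead of a maximum makes sense also for empty \<open>S\<close>.\<close>
  define L where "L = (\<Sum>s\<in>S. d' \<one> s)"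
  have path: "d' x y \<le> L * real n" if "(x, y) \<in> cayley_edges G S ^^ n" "x \<in> carrier G" for x y n
    using that
  proof (induction n arbitrary: y)
    case (Suc n)
    then obtain z where z: "(x, z) \<in> cayley_edges G S ^^ n" "(z, y) \<in> cayley_edges G S" by auto
    then have zy: "z \<in> carrier G" "y \<in> carrier G" "inv z \<otimes> y \<in> S"
      by (auto simp: cayley_edges_def)
    have "d' z y = d' \<one> (inv z \<otimes> y)"
      using inv[of "inv z" z y] zy by simp
    also have "\<dots> \<le> L"
      unfolding L_def using zy finite_S by (intro member_le_sum) auto
    finally show ?case
      using Suc.IH[OF z(1) Suc.prems(2)] d'.triangle[of x z y] zy Suc.prems
      by (simp add: algebra_simps)
  qed auto
  show thesis
  proof (rule that[of L])
    show "L \<ge> 0" unfolding L_def by (intro sum_nonneg) auto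
  next
    fix x y assume "x \<in> carrier G" "y \<in> carrier G"
    then show "d' x y \<le> L * cayley_dist G S x y"
      using path by (metis dist_attained)
  qed
qed

text \<open>Translation by \<open>inv w\<close> moves the base point \<open>w\<close> to the
  identity.\<close>

lemma hyperbolic_spaceI:
  assumes "\<forall>x\<in>carrier G. \<forall>y\<in>carrier G. \<forall>z\<in>carrier G.
          gromov_product G (cayley_dist G S) x y \<ge>
            min (gromov_product G (cayley_dist G S) x z)
                (gromov_product G (cayley_dist G S) z y) - \<delta>"
  shows "hyperbolic_space (carrier G) (cayley_dist G S) (max \<delta> 0)"
proof
  fix w x y z assume wxyz: "w \<in> carrier G" "x \<in> carrier G" "y \<in> carrier G" "z \<in> carrier G"
  have eq: "gromov_product G (cayley_dist G S) (inv w \<otimes> a) (inv w \<otimes> b) =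
      (cayley_dist G S a w + cayley_dist G S b w - cayley_dist G S a b) / 2"
    if "a \<in> carrier G" "b \<in> carrier G" for a b
    using that wxyz dist_translate[of "inv w" a w] dist_translate[of "inv w" b w]
      dist_translate[of "inv w" a b]
    by (simp add: gromov_product_def)
  show "min ((cayley_dist G S x w + cayley_dist G S z w - cayley_dist G S x z) / 2)
        ((cayley_dist G S z w + cayley_dist G S y w - cayley_dist G S z y) / 2) - max \<delta> 0
      \<le> (cayley_dist G S x w + cayley_dist G S y w - cayley_dist G S x y) / 2"
    using assms[rule_format, of "inv w \<otimes> x" "inv w \<otimes> y" "inv w \<otimes> z"] wxyz
    unfolding eq[OF wxyz(2,3)] eq[OF wxyz(2,4)] eq[OF wxyz(4,3)] by simp
qed simp

section \<open>Boundary points as limits of internal functionals\<close>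

lemma internal_functional_Lipschitz:
  "x \<in> carrier G \<Longrightarrow>
    internal_functional G (cayley_dist G S) x \<in> lipschitz_functionals G (cayley_dist G S)"
  using mdist_reverse_triangle[of _ x]
  by (auto simp: internal_functional_def lipschitz_functionals_def commute[of x])

lemma topspace_functional:
  "topspace (functional_topology G d') = lipschitz_functionals G d'"
  by (auto simp: functional_topology_def lipschitz_functionals_def PiE_def)

lemma boundary_Lipschitz:
  "h \<in> metric_functional_boundary G (cayley_dist G S) \<Longrightarrow>
    h \<in> lipschitz_functionals G (cayley_dist G S)"
  using closure_of_subset_topspace[of "functional_topology G (cayley_dist G S)"]
  by (auto simp: metric_functional_boundary_def metric_functional_compactification_def
      topspace_functional)

text \<open>Balls are finite, so the internal functionals of a ball form a closed set in a Hausdorff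
  space. A boundary point is not among them and therefore lies in the closure of those from outside
  the ball.\<close>

lemma boundary_approx:
  assumes h: "h \<in> metric_functional_boundary G (cayley_dist G S)"
    and F: "finite F" "F \<subseteq> carrier G" and "\<epsilon> > 0"
  obtains x where "x \<in> carrier G" "cayley_dist G S x \<one> > r"
    "\<And>y. y \<in> F \<Longrightarrow> \<bar>cayley_dist G S x y - cayley_dist G S x \<one> - h y\<bar> < \<epsilon>"
proof -
  let ?T = "functional_topology G (cayley_dist G S)"
  let ?b = "internal_functional G (cayley_dist G S)"
  define B where "B = {x \<in> carrier G. cayley_dist G S \<one> x \<le> r}"
  have "Hausdorff_space ?T"
    unfolding functional_topology_def
    by (intro Hausdorff_space_subtopology) (simp add: Hausdorff_space_product_topology)
  moreover have "finite (?b ` B)" "?b ` B \<subseteq> topspace ?T"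
    using finite_ball internal_functional_Lipschitz by (auto simp: B_def topspace_functional)
  ultimately have "closedin ?T (?b ` B)"
    by (simp add: closedin_Hausdorff_finite)
  then have clB: "Abstract_Topology.closure_of ?T (?b ` B) = ?b ` B"
    by (simp add: closure_of_closedin)
  have "carrier G = B \<union> (carrier G - B)" by (auto simp: B_def)
  then have "?b ` carrier G = ?b ` B \<union> ?b ` (carrier G - B)" by blast
  then have cl: "h \<in> Abstract_Topology.closure_of ?T (?b ` (carrier G - B))"
    using h clB
    by (auto simp: metric_functional_boundary_def metric_functional_compactification_def
        closure_of_Un B_def)
  define U where "U = PiE (carrier G) (\<lambda>y. if y \<in> F then {t. \<bar>t - h y\<bar> < \<epsilon>} else UNIV)"
  have op: "open {t. \<bar>t - h y\<bar> < \<epsilon>}" for y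
    by (intro open_Collect_less continuous_intros)
  have "openin (product_topology (\<lambda>_. euclideanreal) (carrier G)) U"
    unfolding U_def openin_PiE_gen
    using F op by (auto intro: finite_subset[of _ F])
  then have "openin ?T (U \<inter> lipschitz_functionals G (cayley_dist G S))"
    unfolding functional_topology_def by (auto simp: openin_subtopology)
  moreover have "h \<in> U \<inter> lipschitz_functionals G (cayley_dist G S)"
    using boundary_Lipschitz[OF h] \<open>\<epsilon> > 0\<close>
    by (auto simp: U_def lipschitz_functionals_def PiE_def)
  ultimately obtain f where f: "f \<in> ?b ` (carrier G - B)" "f \<in> U"
    using cl unfolding in_closure_of by blast
  then obtain x where x: "x \<in> carrier G" "x \<notin> B" "f = ?b x" by auto
  show thesis
  proof (rule that[OF x(1)])
    show "cayley_dist G S x \<one> > r"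
      using x by (auto simp: B_def commute)
  next
    fix y assume "y \<in> F"
    then have "y \<in> carrier G" "\<bar>f y - h y\<bar> < \<epsilon>"
      using F f(2) by (auto simp: U_def PiE_def Pi_def split: if_splits)
    then show "\<bar>cayley_dist G S x y - cayley_dist G S x \<one> - h y\<bar> < \<epsilon>"
      using x by (simp add: internal_functional_def)
  qed
qed

lemma dist_Ints: "cayley_dist G S x y \<in> \<int>"
  by (simp add: cayley_dist_def)

lemma boundary_Ints:
  assumes "h \<in> metric_functional_boundary G (cayley_dist G S)" "y \<in> carrier G"
  shows "h y \<in> \<int>"
proof -
  have "\<exists>t\<in>\<int>. dist t (h y) < e" if e: "e > 0" for e
  proof -
    obtain x where "\<bar>cayley_dist G S x y - cayley_dist G S x \<one> - h y\<bar> < e"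
      by (rule boundary_approx[OF assms(1), of "{y}" e 0]) (use assms(2) e in auto)
    then show ?thesis
      using dist_Ints by (metis Ints_diff dist_real_def)
  qed
  then show ?thesis
    using closure_approachable[of "h y" \<int>] by (metis closed_Ints closure_closed)
qed

text \<open>Both sides are integers, so an approximation with error below 1 is exact. Exactness is
  what later makes translated geodesics geodesic again, without error terms.\<close>

lemma boundary_eq_on_finite:
  assumes "h \<in> metric_functional_boundary G (cayley_dist G S)"
    and F: "finite F" "F \<subseteq> carrier G"
  obtains x where "x \<in> carrier G" "cayley_dist G S x \<one> > r"
    "\<And>y. y \<in> F \<Longrightarrow> h y = cayley_dist G S x y - cayley_dist G S x \<one>"
proof -
  obtain x where x: "x \<in> carrier G" "cayley_dist G S x \<one> > r"
    "\<And>y. y \<in> F \<Longrightarrow> \<bar>cayley_dist G S x y - cayley_dist G S x \<one> - h y\<bar> < 1"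
    using boundary_approx[OF assms, of 1 r] by auto
  have "h y = cayley_dist G S x y - cayley_dist G S x \<one>" if "y \<in> F" for y
  proof -
    have "cayley_dist G S x y - cayley_dist G S x \<one> - h y \<in> \<int>"
      using boundary_Ints[OF assms(1)] dist_Ints F that by (intro Ints_diff) auto
    then show ?thesis
      using x(3)[OF that] Ints_nonzero_abs_less1 by fastforce
  qed
  then show thesis using that x by blast
qed

end

section \<open>Finiteness of the part of the stabilizer on which a boundary point is bounded\<close>

lemma geodesic_bilipschitz:
  assumes "hyperbolic_space M d\<^sub>0 \<delta>"
    and p: "p ` {..n} \<subseteq> M" "geodesic_path d p n"
    and "\<And>x y. \<lbrakk>x \<in> M; y \<in> M\<rbrakk> \<Longrightarrow> d\<^sub>0 x y \<le> L * d x y"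
    and "\<And>x y. \<lbrakk>x \<in> M; y \<in> M\<rbrakk> \<Longrightarrow> d x y \<le> L * d\<^sub>0 x y"
  shows "hyperbolic_space.bilipschitz_path d\<^sub>0 L p n"
  using assms(2-) unfolding hyperbolic_space.bilipschitz_path_def[OF assms(1)] geodesic_path_def
  by (metis atMost_iff image_subset_iff)

text \<open>The additivity condition stands for membership in the stabilizer. Finite subsets
  \<open>F\<close> are bounded in size uniformly: the choices of \<open>R\<close>,
  \<open>m0\<close>, \<open>x\<close> and \<open>n\<close> depend on \<open>F\<close>, but the
  radius \<open>B\<close> does not.\<close>

lemma finite_bounded_stabilizer:
  fixes G (structure)
  assumes "word_metric G S" "word_metric G S\<^sub>0"
    and hyp: "hyperbolic_space (carrier G) (cayley_dist G S\<^sub>0) \<delta>"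
    and h: "h \<in> metric_functional_boundary G (cayley_dist G S)"
  shows "finite {q \<in> carrier G. \<bar>h q\<bar> \<le> c \<and> (\<forall>y\<in>carrier G. h (q \<otimes> y) = h q + h y)}"
    (is "finite ?E")
proof -
  interpret W: word_metric G S by fact
  interpret W0: word_metric G S\<^sub>0 by fact
  let ?d = "cayley_dist G S" and ?e = "cayley_dist G S\<^sub>0"
  interpret H: hyperbolic_space "carrier G" ?e \<delta> by fact
  obtain L1 where L1: "L1 \<ge> 0"
    "\<And>x y. \<lbrakk>x \<in> carrier G; y \<in> carrier G\<rbrakk> \<Longrightarrow> ?e x y \<le> L1 * ?d x y"
    by (rule W.dominates_invariant_metric[OF W0.Metric_space_axioms]) (auto simp: W0.dist_translate)
  obtain L2 where L2: "L2 \<ge> 0"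
    "\<And>x y. \<lbrakk>x \<in> carrier G; y \<in> carrier G\<rbrakk> \<Longrightarrow> ?d x y \<le> L2 * ?e x y"
    by (rule W0.dominates_invariant_metric[OF W.Metric_space_axioms]) (auto simp: W.dist_translate)
  define L where "L = max 1 (max L1 L2)"
  have L: "L \<ge> 1" and L12: "L1 \<le> L" "L2 \<le> L" by (simp_all add: L_def)
  have d0_le: "?e x y \<le> L * ?d x y" if "x \<in> carrier G" "y \<in> carrier G" for x y
    using L1(2)[OF that] mult_right_mono[OF L12(1), of "?d x y"] by simp
  have d_le: "?d x y \<le> L * ?e x y" if "x \<in> carrier G" "y \<in> carrier G" for x y
    using L2(2)[OF that] mult_right_mono[OF L12(2), of "?e x y"] by simp
  have geodesic_bl: "H.bilipschitz_path L p n"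
    if "p ` {..n} \<subseteq> carrier G" "geodesic_path ?d p n" for p n
    using hyp that by (rule geodesic_bilipschitz) (simp_all add: d0_le d_le)
  obtain D where D: "D \<ge> 0"
    "\<And>g n p N i. \<lbrakk>g ` {..n} \<subseteq> carrier G; geodesic_path ?e g n;
       p ` {..N} \<subseteq> carrier G; H.bilipschitz_path L p N; p 0 = g 0; p N = g n; i \<le> n\<rbrakk>
       \<Longrightarrow> \<exists>j\<le>N. ?e (g i) (p j) \<le> D"
    by (rule H.morse[OF L]) blast
  \<comment> \<open>\<open>A\<close> bounds the distance from \<open>\<alpha> n\<close> to some
    \<open>q \<otimes> \<alpha> m\<close>, both being near one point \<open>z\<close>;
    \<open>B\<close> adds the cost of replacing \<open>m\<close> by \<open>n\<close>.\<close>
  define A where "A = 2 * D + 4 * \<delta>"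
  define B where "B = A + L * (L * A + c)"
  have Lip: "\<bar>h x - h y\<bar> \<le> ?d x y" if "x \<in> carrier G" "y \<in> carrier G" for x y
    using W.boundary_Lipschitz[OF h] that by (auto simp: lipschitz_functionals_def)
  have "card F \<le> card {x \<in> carrier G. ?e \<one> x \<le> B}" if F: "F \<subseteq> ?E" "finite F" for F
  proof -
    have FG: "F \<subseteq> carrier G" using F by auto
    \<comment> \<open>At distance \<open>R\<close> from the identity, a point \<open>z\<close> has
      Gromov product above \<delta> with \<one> and any \<open>q\<close> in \<open>F\<close>, so
      geodesics from \<one> and from \<open>q\<close> to the far point \<open>x\<close> both pass
      near \<open>z\<close>.\<close>
    define R where "R = nat \<lceil>\<delta> + (\<Sum>q\<in>F. ?e \<one> q)\<rceil> + 1"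
    have R: "?e \<one> q + \<delta> < real R" if "q \<in> F" for q
    proof -
      have "?e \<one> q \<le> (\<Sum>q\<in>F. ?e \<one> q)"
        using F that by (intro member_le_sum) auto
      then show ?thesis unfolding R_def by linarith
    qed
    \<comment> \<open>An upper bound for the time at which the paths from \<one> and from
      \<open>q\<close> are found near \<open>z\<close>; only this initial part of \<alpha> is
      translated.\<close>
    define m0 where "m0 = nat \<lceil>L * (2 * real R + 4 * \<delta> + D)\<rceil>"
    have m0: "L * (2 * real R + 4 * \<delta> + D) \<le> real m0"
      unfolding m0_def by linarith
    \<comment> \<open>The ball of radius \<open>r\<close> contains the first \<open>m0\<close> steps
      of \<alpha> and their translates by \<open>F\<close>, so that \<open>x\<close> computes
      \<open>h\<close> on all of them.\<close>
    define r where "r = real m0 + (\<Sum>q\<in>F. ?d \<one> q)"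
    have r: "real m0 + ?d \<one> q \<le> r" if "q \<in> F" for q
      using F that unfolding r_def by (intro add_left_mono member_le_sum) auto
    have r0: "real m0 \<le> r" unfolding r_def by (simp add: sum_nonneg)
    \<comment> \<open>The summand \<open>L * real R\<close> makes the geodesic \<open>g\<close>
      reach time \<open>R\<close>, and \<open>real m0\<close> makes \<alpha> reach time
      \<open>m0\<close>.\<close>
    obtain x where x: "x \<in> carrier G" "?d x \<one> > L * real R + real m0"
      "\<And>y. y \<in> carrier G \<Longrightarrow> ?d \<one> y \<le> r \<Longrightarrow> h y = ?d x y - ?d x \<one>"
      by (rule W.boundary_eq_on_finite[OF h, of "{y \<in> carrier G. ?d \<one> y \<le> r}" "L * real R + real m0"])
        (use W.finite_ball in auto)
    obtain g n0 where g: "?e \<one> x = real n0" "g 0 = \<one>" "g n0 = x"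
      "g ` {..n0} \<subseteq> carrier G" "geodesic_path ?e g n0"
      using W0.geodesic_exists[OF W.one_closed x(1)] by metis
    have "L * real R \<le> L * ?e \<one> x"
      using x d_le[of x \<one>] by (simp add: W0.commute)
    then have Rn0: "R \<le> n0" using L g by simp
    have gG: "g i \<in> carrier G" if "i \<le> n0" for i
      using g(4) that by auto
    define z where "z = g R"
    have z: "z \<in> carrier G" "?e \<one> z = real R" "?e z x = real n0 - real R"
      using g gG[OF Rn0] Rn0 by (auto simp: z_def geodesic_path_def)
    obtain \<alpha> n1 where \<alpha>: "?d \<one> x = real n1" "\<alpha> 0 = \<one>" "\<alpha> n1 = x"
      "\<alpha> ` {..n1} \<subseteq> carrier G" "geodesic_path ?d \<alpha> n1"
      using W.geodesic_exists[OF W.one_closed x(1)] by metis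
    have "real m0 \<le> real n1"
      using x(2) \<alpha>(1) W.commute[of x \<one>] mult_nonneg_nonneg[of L "real R"] L by linarith
    then have m0n1: "m0 \<le> n1" by simp
    have \<alpha>G: "\<alpha> i \<in> carrier G" if "i \<le> n1" for i
      using \<alpha>(4) that by auto
    have \<alpha>d: "?d (\<alpha> i) (\<alpha> j) = \<bar>real i - real j\<bar>" if "i \<le> n1" "j \<le> n1" for i j
      using \<alpha> that by (auto simp: geodesic_path_def)
    obtain n where n: "n \<le> n1" "?e z (\<alpha> n) \<le> D"
      using D(2)[OF g(4,5) \<alpha>(4) geodesic_bl[OF \<alpha>(4,5)] _ _ Rn0] \<alpha>(2,3) g(2,3)
      by (auto simp: z_def)
    have "real n \<le> L * ?e \<one> (\<alpha> n)"
      using d_le[of \<one> "\<alpha> n"] \<alpha>d[of 0 n] \<alpha>(2) \<alpha>G n by simp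
    also have "\<dots> \<le> L * (real R + D)"
      using W0.triangle[of \<one> z "\<alpha> n"] z \<alpha>G n L by (intro mult_left_mono) auto
    also have "\<dots> \<le> L * (2 * real R + 4 * \<delta> + D)"
      using L H.\<delta>_nonneg by (intro mult_left_mono) auto
    finally have nm0: "n \<le> m0" using m0 by linarith
    have h\<alpha>: "h (\<alpha> i) = - real i" if "i \<le> m0" for i
    proof -
      have "h (\<alpha> i) = ?d x (\<alpha> i) - ?d x \<one>"
        using \<alpha>d[of 0 i] \<alpha>(2) \<alpha>G that m0n1 r0 by (intro x(3)) auto
      then show ?thesis
        using \<alpha>d[of n1 i] \<alpha>(1,3) W.commute[of x \<one>] that m0n1 by simp
    qed
    have conj: "?e \<one> (inv (\<alpha> n) \<otimes> (q \<otimes> \<alpha> n)) \<le> B" if qF: "q \<in> F" for q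
    proof -
      have q: "q \<in> carrier G" "\<bar>h q\<bar> \<le> c" "\<And>y. y \<in> carrier G \<Longrightarrow> h (q \<otimes> y) = h q + h y"
        using F qF by auto
      \<comment> \<open>Additivity gives \<open>h (q \<otimes> \<alpha> i) = h q - i\<close>, so the
        translate of \<alpha> approaches \<open>x\<close> at unit speed.\<close>
      have dqx: "?d x (q \<otimes> \<alpha> i) = ?d x q - real i" if "i \<le> m0" for i
      proof -
        have "?d \<one> (q \<otimes> \<alpha> i) \<le> ?d \<one> q + ?d q (q \<otimes> \<alpha> i)"
          using q \<alpha>(2) \<alpha>G that m0n1 by (intro W.triangle) auto
        also have "?d q (q \<otimes> \<alpha> i) = real i"
          using W.dist_translate[of q \<one> "\<alpha> i"] \<alpha>d[of 0 i] \<alpha>(2) \<alpha>G q that m0n1 by simp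
        finally have "h (q \<otimes> \<alpha> i) = ?d x (q \<otimes> \<alpha> i) - ?d x \<one>"
          using r[OF qF] q \<alpha>(2) \<alpha>G that m0n1 by (intro x(3)) auto
        moreover have "h q = ?d x q - ?d x \<one>"
          using r[OF qF] q by (intro x(3)) auto
        ultimately show ?thesis
          using q(3)[of "\<alpha> i"] h\<alpha>[OF that] \<alpha>G that m0n1 by simp
      qed
      obtain \<rho> n2 where \<rho>: "?d (q \<otimes> \<alpha> m0) x = real n2" "\<rho> 0 = q \<otimes> \<alpha> m0" "\<rho> n2 = x"
        "\<rho> ` {..n2} \<subseteq> carrier G" "geodesic_path ?d \<rho> n2"
        using W.geodesic_exists[OF W.m_closed[OF q(1) \<alpha>G[OF m0n1]] x(1)] by metis
      have \<rho>G: "\<rho> i \<in> carrier G" if "i \<le> n2" for i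
        using \<rho>(4) that by auto
      \<comment> \<open>The translated initial part followed by a geodesic to \<open>x\<close>; by
        \<open>dqx\<close> at \<open>m0\<close> the total length is the distance from
        \<open>q\<close> to \<open>x\<close>.\<close>
      define \<beta> where "\<beta> i = (if i \<le> m0 then q \<otimes> \<alpha> i else \<rho> (i - m0))" for i
      have \<beta>G: "\<beta> i \<in> carrier G" if "i \<le> m0 + n2" for i
        using that q \<alpha>G \<rho>G m0n1 by (auto simp: \<beta>_def)
      have \<beta>\<rho>: "\<beta> i = \<rho> (i - m0)" if "i \<ge> m0" for i
        using that \<rho> by (auto simp: \<beta>_def)
      have \<beta>0: "\<beta> 0 = q" and \<beta>n: "\<beta> (m0 + n2) = x"
        using \<alpha> q \<rho> \<beta>\<rho>[of "m0 + n2"] by (auto simp: \<beta>_def)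
      have \<beta>_geo: "geodesic_path ?d \<beta> (m0 + n2)"
      proof (rule W.geodesic_pathI)
        fix i assume i: "i < m0 + n2"
        show "?d (\<beta> i) (\<beta> (Suc i)) \<le> 1"
        proof (cases "i < m0")
          case True
          then show ?thesis
            using W.dist_translate[of q "\<alpha> i" "\<alpha> (Suc i)"] \<alpha>d[of i "Suc i"] q \<alpha>(2) \<alpha>G m0n1
            by (simp add: \<beta>_def)
        next
          case False
          then show ?thesis
            using \<beta>\<rho>[of i] \<beta>\<rho>[of "Suc i"] \<rho>(5) i by (auto simp: geodesic_path_def)
        qed
      next
        show "real (m0 + n2) \<le> ?d (\<beta> 0) (\<beta> (m0 + n2))"
          using dqx[of m0] \<rho> by (simp add: \<beta>0 \<beta>n W.commute)
      qed (use \<beta>G in auto)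
      \<comment> \<open>The product of \<one> and \<open>x\<close> at \<open>z\<close> vanishes
        because \<open>z\<close> lies on \<open>g\<close>. That of \<one> and \<open>q\<close>
        exceeds \<delta>, so the minimum must be the remaining one.\<close>
      have "H.gp z q x \<le> \<delta>"
      proof -
        have "H.gp z \<one> x = 0"
          using z g by (simp add: H.gp_def W0.commute)
        moreover have "H.gp z \<one> x \<ge> min (H.gp z \<one> q) (H.gp z q x) - \<delta>"
          using z x q by (intro H.gp_ge_min) auto
        moreover have "H.gp z \<one> q > \<delta>"
          using H.gp_ge_diff[of z \<one> q] R[OF qF] z q by simp
        ultimately show ?thesis by (simp add: min_def split: if_splits)
      qed
      obtain g' n3 where g': "g' 0 = q" "g' n3 = x"
        "g' ` {..n3} \<subseteq> carrier G" "geodesic_path ?e g' n3"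
        using W0.geodesic_exists[OF q(1) x(1)] by metis
      have g'G: "g' i \<in> carrier G" if "i \<le> n3" for i
        using g'(3) that by auto
      obtain a where "?e q z = real a"
        using W0.dist_attained q z by metis
      then obtain i where i: "i \<le> n3" "?e z (g' i) \<le> 4 * \<delta>"
        using H.geodesic_near_point[OF g'(3,4) z(1)] \<open>H.gp z q x \<le> \<delta>\<close> g' by auto
      have \<beta>G': "\<beta> ` {..m0 + n2} \<subseteq> carrier G"
        using \<beta>G by auto
      obtain m where m: "m \<le> m0 + n2" "?e (g' i) (\<beta> m) \<le> D"
        using D(2)[OF g'(3,4) \<beta>G' geodesic_bl[OF \<beta>G' \<beta>_geo] _ _ i(1)] g' \<beta>0 \<beta>n by auto
      have z\<beta>: "?e z (\<beta> m) \<le> 4 * \<delta> + D"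
        using W0.triangle[of z "g' i" "\<beta> m"] z g'G i m \<beta>G by auto
      have "real m \<le> L * ?e q (\<beta> m)"
        using d_le[of q "\<beta> m"] \<beta>_geo \<beta>0 \<beta>G m q by (auto simp: geodesic_path_def)
      also have "\<dots> \<le> L * (2 * real R + 4 * \<delta> + D)"
      proof (intro mult_left_mono)
        have "?e q (\<beta> m) \<le> ?e q \<one> + (?e \<one> z + ?e z (\<beta> m))"
          using W0.triangle[of q \<one> "\<beta> m"] W0.triangle[of \<one> z "\<beta> m"] q z \<beta>G m by auto
        then show "?e q (\<beta> m) \<le> 2 * real R + 4 * \<delta> + D"
          using R[OF qF] z z\<beta> H.\<delta>_nonneg by (simp add: W0.commute)
      qed (use L in auto)
      finally have mm0: "m \<le> m0" using m0 by linarith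
      then have \<beta>m: "\<beta> m = q \<otimes> \<alpha> m" by (simp add: \<beta>_def)
      have G: "\<alpha> n \<in> carrier G" "\<alpha> m \<in> carrier G" using \<alpha>G nm0 mm0 m0n1 by auto
      have nm: "?e (\<alpha> n) (q \<otimes> \<alpha> m) \<le> A"
        using W0.triangle[of "\<alpha> n" z "q \<otimes> \<alpha> m"] n z\<beta> \<beta>m G q z
        by (simp add: A_def W0.commute)
      \<comment> \<open>The two values are \<open>- n\<close> and \<open>h q - m\<close>, so the
        Lipschitz property of \<open>h\<close> synchronizes the times up to
        \<open>L * A + c\<close>.\<close>
      have "\<bar>h (\<alpha> n) - h (q \<otimes> \<alpha> m)\<bar> \<le> L * A"
        using Lip[OF G(1) W.m_closed[OF q(1) G(2)]] d_le[OF G(1) W.m_closed[OF q(1) G(2)]]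
          mult_left_mono[OF nm, of L] L
        by linarith
      then have "\<bar>real m - real n\<bar> \<le> L * A + c"
        using h\<alpha>[OF nm0] h\<alpha>[OF mm0] q(2) q(3)[OF G(2)] by linarith
      moreover have "?e (q \<otimes> \<alpha> m) (q \<otimes> \<alpha> n) \<le> L * \<bar>real m - real n\<bar>"
        using d0_le[OF G(2,1)] W0.dist_translate[OF q(1) G(2,1)] \<alpha>d[of m n] nm0 mm0 m0n1 by simp
      ultimately have "?e (q \<otimes> \<alpha> m) (q \<otimes> \<alpha> n) \<le> L * (L * A + c)"
        using mult_left_mono[of "\<bar>real m - real n\<bar>" "L * A + c" L] L by linarith
      then have "?e (\<alpha> n) (q \<otimes> \<alpha> n) \<le> B"
        using W0.triangle[of "\<alpha> n" "q \<otimes> \<alpha> m" "q \<otimes> \<alpha> n"] nm G q by (simp add: B_def)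
      then show ?thesis
        using W0.dist_translate[of "inv (\<alpha> n)" "\<alpha> n" "q \<otimes> \<alpha> n"] G q by simp
    qed
    have "\<alpha> n \<in> carrier G" using \<alpha>G n by auto
    \<comment> \<open>Here it matters that \<open>n\<close> was chosen before \<open>q\<close>: all
      of \<open>F\<close> is conjugated by the same element.\<close>
    then have "inj_on (\<lambda>q. inv (\<alpha> n) \<otimes> (q \<otimes> \<alpha> n)) F"
      using FG by (intro inj_onI)
        (metis W.inv_closed W.Units_l_cancel W.Units_eq W.m_closed W.right_cancel subsetD)
    moreover have "(\<lambda>q. inv (\<alpha> n) \<otimes> (q \<otimes> \<alpha> n)) ` F \<subseteq> {x \<in> carrier G. ?e \<one> x \<le> B}"
      using conj FG \<open>\<alpha> n \<in> carrier G\<close> by auto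
    ultimately show ?thesis
      using W0.finite_ball card_inj_on_le by blast
  qed
  then have "finite ?E \<and> card ?E \<le> card {x \<in> carrier G. ?e \<one> x \<le> B}"
    by (intro finite_if_finite_subsets_card_bdd)
  then show ?thesis ..
qed

section \<open>Criterion for virtual cyclicity, the action on functionals, and finite orbits\<close>

lemma (in group) virtually_cyclicI:
  assumes "t \<in> carrier G" "finite T"
    and "\<And>g. g \<in> carrier G \<Longrightarrow> \<exists>k::int. \<exists>u\<in>T. u \<in> carrier G \<and> g = t [^] k \<otimes> u"
  shows "virtually_cyclic G"
proof -
  let ?H = "range (\<lambda>k::int. t [^] k)"
  have sub: "subgroup ?H G"
    using generate_is_subgroup[of "{t}"] assms(1) by (simp add: generate_pow full_SetCompr_eq)
  interpret Hg: group "G\<lparr>carrier := ?H\<rparr>"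
    using sub by (rule subgroup_imp_group)
  have "t = t [^] (1::int)"
    using assms(1) by simp
  then have tH: "t \<in> ?H" by (rule range_eqI)
  have "cyclic_group (G\<lparr>carrier := ?H\<rparr>)"
    unfolding Hg.cyclic_group
    by (rule bexI[of _ t]) (use tH in \<open>simp_all add: int_pow_consistent[OF sub tH, symmetric]\<close>)
  \<comment> \<open>The coset of \<open>g\<close> is that of the \<open>u\<close> obtained by
    splitting off a power of \<open>t\<close>.\<close>
  moreover have "rcosets ?H \<subseteq> (\<lambda>u. ?H #> u) ` T"
  proof
    fix C assume "C \<in> rcosets ?H"
    then obtain g where g: "g \<in> carrier G" "C = ?H #> g" by (auto simp: RCOSETS_def)
    then obtain k :: int and u where u: "u \<in> T" "u \<in> carrier G" "g = t [^] k \<otimes> u"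
      using assms(3) by blast
    have "?H #> g = (?H #> t [^] k) #> u"
      using u sub assms(1) by (simp add: coset_mult_assoc subgroup.subset)
    also have "?H #> t [^] k = ?H"
      using sub by (intro coset_join2) (auto simp: assms(1))
    finally show "C \<in> (\<lambda>u. ?H #> u) ` T" using g u by auto
  qed
  ultimately show ?thesis
    unfolding virtually_cyclic_def using sub assms(2) by (meson finite_imageI finite_subset)
qed

lemma (in group) functional_action_mult:
  assumes "x \<in> carrier G" "y \<in> carrier G"
  shows "functional_action G (x \<otimes> y) h = functional_action G x (functional_action G y h)"
  using assms by (auto simp: functional_action_def inv_mult_group m_assoc)

lemma (in group) functional_action_one:
  assumes "h \<in> extensional (carrier G)" "h \<one> = 0"
  shows "functional_action G \<one> h = h"
  using assms by (auto simp: functional_action_def extensional_def)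

text \<open>Evaluating the fixed-point equation at \<open>x\<close> gives
  \<open>h x = - h (inv x)\<close>, and at \<open>x \<otimes> y\<close> the claim. Here
  \<open>y\<close> need not fix \<open>h\<close>.\<close>

lemma (in group) functional_action_fixed:
  assumes x: "x \<in> carrier G" and fix_h: "functional_action G x h = h" and h1: "h \<one> = 0"
    and y: "y \<in> carrier G"
  shows "h (x \<otimes> y) = h x + h y"
proof -
  have *: "h y = h (inv x \<otimes> y) - h (inv x)" if "y \<in> carrier G" for y
    using fun_cong[OF fix_h, of y] that by (simp add: functional_action_def)
  show ?thesis
    using *[of "x \<otimes> y"] *[of x] x y h1 by (simp flip: m_assoc)
qed

theorem theorem2p2:
  fixes G :: "('a, 'b) monoid_scheme" and S :: "'a set"
  assumes "group G"
    and "finitely_generated G"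
    and "gromov_hyperbolic G"
    and "\<not> virtually_cyclic G"
    and "finite_symmetric_generating_set G S"
  shows "\<forall>h \<in> metric_functional_boundary G (cayley_dist G S).
           infinite (orbit G (functional_action G) h)"
proof
  fix h assume h: "h \<in> metric_functional_boundary G (cayley_dist G S)"
  interpret group G by fact
  interpret W: word_metric G S by unfold_locales fact
  obtain S\<^sub>0 \<delta> where S0: "finite_symmetric_generating_set G S\<^sub>0"
    "\<forall>x\<in>carrier G. \<forall>y\<in>carrier G. \<forall>z\<in>carrier G.
          gromov_product G (cayley_dist G S\<^sub>0) x y \<ge>
            min (gromov_product G (cayley_dist G S\<^sub>0) x z)
                (gromov_product G (cayley_dist G S\<^sub>0) z y) - \<delta>"
    using assms(3) unfolding gromov_hyperbolic_def by blast
  interpret W0: word_metric G S\<^sub>0 by unfold_locales (rule S0)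
  have h1: "h \<one>\<^bsub>G\<^esub> = 0" and h_ext: "h \<in> extensional (carrier G)"
    using W.boundary_Lipschitz[OF h] by (auto simp: lipschitz_functionals_def)
  let ?act = "functional_action G"
  show "infinite (orbit G ?act h)"
  proof
    assume fin: "finite (orbit G ?act h)"
    define Stab where "Stab = {q \<in> carrier G. ?act q h = h}"
    have Stab_mult: "p \<otimes>\<^bsub>G\<^esub> q \<in> Stab" if "p \<in> Stab" "q \<in> Stab" for p q
      using that functional_action_mult[of p q h] by (auto simp: Stab_def)
    have Stab_one: "\<one>\<^bsub>G\<^esub> \<in> Stab"
      using functional_action_one[OF h_ext h1] by (simp add: Stab_def)
    have Stab_inv: "inv\<^bsub>G\<^esub> q \<in> Stab" if "q \<in> Stab" for q
      using that functional_action_mult[of "inv\<^bsub>G\<^esub> q" q h] functional_action_one[OF h_ext h1]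
      by (auto simp: Stab_def)
    have additive: "h (q \<otimes>\<^bsub>G\<^esub> y) = h q + h y" if "q \<in> Stab" "y \<in> carrier G" for q y
      using that functional_action_fixed h1 by (auto simp: Stab_def)
    have h_inv: "h (inv\<^bsub>G\<^esub> q) = - h q" if "q \<in> Stab" for q
      using additive[OF that, of "inv\<^bsub>G\<^esub> q"] that h1 by (simp add: Stab_def)
    have finite_level: "finite {q \<in> Stab. \<bar>h q\<bar> \<le> c}" for c
      by (rule finite_subset[OF _ finite_bounded_stabilizer[OF W.word_metric_axioms
            W0.word_metric_axioms W0.hyperbolic_spaceI[OF S0(2)] h, of c]])
         (auto simp: Stab_def additive)
    define rep where "rep f = (SOME r. r \<in> carrier G \<and> ?act r h = f)" for f
    \<comment> \<open>If \<open>r\<close> and \<open>inv g\<close> send \<open>h\<close> to the same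
      point, then \<open>g \<otimes> r\<close> fixes \<open>h\<close> and
      \<open>g = (g \<otimes> r) \<otimes> inv r\<close>. Hence inverses of orbit representatives
      represent all right cosets of \<open>Stab\<close>.\<close>
    define V where "V = (\<lambda>f. inv\<^bsub>G\<^esub> (rep f)) ` orbit G ?act h"
    have rep: "rep (?act g h) \<in> carrier G" "?act (rep (?act g h)) h = ?act g h"
      if "g \<in> carrier G" for g
      using someI[of "\<lambda>r. r \<in> carrier G \<and> ?act r h = ?act g h" g] that
      by (auto simp: rep_def)
    have V: "finite V" "V \<subseteq> carrier G"
      using fin rep by (auto simp: V_def orbit_def)
    have split: "\<exists>q\<in>Stab. \<exists>v\<in>V. g = q \<otimes>\<^bsub>G\<^esub> v" if g: "g \<in> carrier G" for g
    proof -
      let ?r = "rep (?act (inv\<^bsub>G\<^esub> g) h)"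
      have r: "?r \<in> carrier G" "?act ?r h = ?act (inv\<^bsub>G\<^esub> g) h"
        using rep[of "inv\<^bsub>G\<^esub> g"] g by auto
      have "?act (g \<otimes>\<^bsub>G\<^esub> ?r) h = ?act (g \<otimes>\<^bsub>G\<^esub> inv\<^bsub>G\<^esub> g) h"
        using g r by (simp only: functional_action_mult inv_closed)
      then have "g \<otimes>\<^bsub>G\<^esub> ?r \<in> Stab"
        using g r functional_action_one[OF h_ext h1] by (simp add: Stab_def)
      moreover have "inv\<^bsub>G\<^esub> ?r \<in> V"
        using g unfolding V_def orbit_def by blast
      moreover have "g = (g \<otimes>\<^bsub>G\<^esub> ?r) \<otimes>\<^bsub>G\<^esub> inv\<^bsub>G\<^esub> ?r"
        using g r by (simp add: m_assoc)
      ultimately show ?thesis by blast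
    qed
    have "virtually_cyclic G"
    proof (cases "\<exists>t\<in>Stab. h t \<noteq> 0")
      case True
      then obtain t where t: "t \<in> Stab" "h t \<noteq> 0" by blast
      then have tG: "t \<in> carrier G" by (simp add: Stab_def)
      have nat_pow: "t [^]\<^bsub>G\<^esub> n \<in> Stab \<and> h (t [^]\<^bsub>G\<^esub> n) = real n * h t" for n :: nat
      proof (induction n)
        case (Suc n)
        then show ?case
          using Stab_mult t additive tG by (auto simp: algebra_simps)
      qed (simp add: Stab_one h1)
      have int_pow: "t [^]\<^bsub>G\<^esub> k \<in> Stab" "h (t [^]\<^bsub>G\<^esub> k) = of_int k * h t" for k :: int
        using nat_pow[of "nat k"] nat_pow[of "nat (- k)"]
          Stab_inv[of "t [^]\<^bsub>G\<^esub> nat (- k)"] h_inv[of "t [^]\<^bsub>G\<^esub> nat (- k)"]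
        unfolding int_pow_def2 by (cases "k < 0"; simp)+
      let ?E = "{q \<in> Stab. \<bar>h q\<bar> \<le> \<bar>h t\<bar>}"
      show ?thesis
      proof (rule virtually_cyclicI[OF tG])
        show "finite ((\<lambda>(q, v). q \<otimes>\<^bsub>G\<^esub> v) ` (?E \<times> V))"
          using finite_level V by simp
      next
        fix g assume "g \<in> carrier G"
        then obtain q v where qv: "q \<in> Stab" "v \<in> V" "g = q \<otimes>\<^bsub>G\<^esub> v"
          using split by blast
        then have G: "q \<in> carrier G" "v \<in> carrier G"
          using V by (auto simp: Stab_def)
        \<comment> \<open>Division with remainder by \<open>h t\<close>, whose sign does not matter:
          the remainder \<open>q'\<close> lies in the finite set \<open>?E\<close>.\<close>
        define k where "k = \<lfloor>h q / h t\<rfloor>"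
        define q' where "q' = t [^]\<^bsub>G\<^esub> (- k) \<otimes>\<^bsub>G\<^esub> q"
        have q': "q' \<in> Stab" "h q' = h t * (h q / h t - of_int k)"
          unfolding q'_def using int_pow[of "- k"] qv Stab_mult additive G t
          by (auto simp: algebra_simps)
        have "\<bar>h q / h t - of_int k\<bar> \<le> 1"
          unfolding k_def by linarith
        then have "\<bar>h q'\<bar> \<le> \<bar>h t\<bar>"
          unfolding q' abs_mult by (intro mult_left_le) auto
        then have "q' \<otimes>\<^bsub>G\<^esub> v \<in> (\<lambda>(q, v). q \<otimes>\<^bsub>G\<^esub> v) ` (?E \<times> V)"
          using q'(1) qv by force
        moreover have "g = t [^]\<^bsub>G\<^esub> k \<otimes>\<^bsub>G\<^esub> (q' \<otimes>\<^bsub>G\<^esub> v)" "q' \<otimes>\<^bsub>G\<^esub> v \<in> carrier G"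
          using qv G tG by (auto simp: q'_def int_pow_neg simp flip: m_assoc)
        ultimately show "\<exists>k::int. \<exists>u\<in>(\<lambda>(q, v). q \<otimes>\<^bsub>G\<^esub> v) ` (?E \<times> V).
            u \<in> carrier G \<and> g = t [^]\<^bsub>G\<^esub> k \<otimes>\<^bsub>G\<^esub> u"
          by blast
      qed
    next
      case False
      \<comment> \<open>Since \<open>h\<close> vanishes on \<open>Stab\<close>, the level bound 0
        already captures all of it. The group is then finite, and the criterion applies with the
        identity as \<open>t\<close>.\<close>
      then have "{q \<in> Stab. \<bar>h q\<bar> \<le> 0} = Stab" by auto
      then have finS: "finite Stab" using finite_level[of 0] by simp
      have "carrier G \<subseteq> (\<lambda>(q, v). q \<otimes>\<^bsub>G\<^esub> v) ` (Stab \<times> V)"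
        using split by fastforce
      then have "finite (carrier G)"
        using finite_subset finS V by blast
      then show ?thesis
        by (rule virtually_cyclicI[OF one_closed]) (auto intro!: exI[of _ "0::int"])
    qed
    then show False using assms(4) by simp
  qed
qed

end
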